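(* For all integers $m\ge 0$ and $n\ge 1$, $$\frac{1}{(A_1^{(n)})^2}\sum_{k=0}^m\binom{m}{k}T_{k}^{(s_{1,0}^{(n)},s_{1,1}^{(n)},s_{1,2}^{(n)})} T_{m-k}^{(s_{1,0}^{(n)},s_{1,1}^{(n)},s_{1,2}^{(n)})} =\frac{2^m}{A_1^{(2n)}}T_{m}^{(s_{1,0}^{(2n)},s_{1,1}^{(2n)},s_{1,2}^{(2n)})} +\frac{2}{A_2^{(n)}}\sum_{k=0}^m\binom{m}{k}(-1)^k T_{k}^{(s_{2,0}^{(n)},s_{2,1}^{(n)},s_{2,2}^{(n)})}.$$
   Context: Let $\alpha,\beta,\gamma$ be the three distinct complex roots of $x^3-x^2-x-1=0$, and set $c_1=\frac{\alpha}{(\alpha-\beta)(\alpha-\gamma)}$, $c_2=\frac{\beta}{(\beta-\alpha)(\beta-\gamma)}$, $c_3=\frac{\gamma}{(\gamma-\alpha)(\gamma-\beta)}$. For numbers $s_0,s_1,s_2$, the sequence $T_k^{(s_0,s_1,s_2)}$ is defined by $T_0^{(s_0,s_1,s_2)}=s_0$, $T_1^{(s_0,s_1,s_2)}=s_1$, $T_2^{(s_0,s_1,s_2)}=s_2$ and $T_k^{(s_0,s_1,s_2)}=T_{k-1}^{(s_0,s_1,s_2)}+T_{k-2}^{(s_0,s_1,s_2)}+T_{k-3}^{(s_0,s_1,s_2)}$ for $k\ge3$. For each integer $N\ge1$, let $A_1^{(N)}\neq0$ and $s_{1,0}^{(N)},s_{1,1}^{(N)},s_{1,2}^{(N)}$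 be numbers such that $c_1^Ne^{\alpha x}+c_2^Ne^{\beta x}+c_3^Ne^{\gamma x}=\frac{1}{A_1^{(N)}}\sum_{k\ge0}T_k^{(s_{1,0}^{(N)},s_{1,1}^{(N)},s_{1,2}^{(N)})}\frac{x^k}{k!}$, and let $A_2^{(N)}\neq0$ and $s_{2,0}^{(N)},s_{2,1}^{(N)},s_{2,2}^{(N)}$ be numbers such that $(c_2c_3)^Ne^{\alpha x}+(c_3c_1)^Ne^{\beta x}+(c_1c_2)^Ne^{\gamma x}=\frac{1}{A_2^{(N)}}\sum_{k\ge0}T_k^{(s_{2,0}^{(N)},s_{2,1}^{(N)},s_{2,2}^{(N)})}\frac{x^k}{k!}$ (in the paper these are specific integer normalizations). *)

theory Defs
  imports Complex_Main
begin

fun trib :: "complex \<Rightarrow> complex \<Rightarrow> complex \<Rightarrow> nat \<Rightarrow> complex" where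
  "trib s0 s1 s2 0 = s0"
| "trib s0 s1 s2 (Suc 0) = s1"
| "trib s0 s1 s2 (Suc (Suc 0)) = s2"
| "trib s0 s1 s2 (Suc (Suc (Suc k))) =
     trib s0 s1 s2 (Suc (Suc k)) + trib s0 s1 s2 (Suc k) + trib s0 s1 s2 k"

lemma norm_trib_le:
  "norm (trib s0 s1 s2 k) \<le> (norm s0 + norm s1 + norm s2) * 2 ^ k"
proof (induction s0 s1 s2 k rule: trib.induct)
  case (4 s0 s1 s2 k)
  define C where "C = norm s0 + norm s1 + norm s2"
  have C: "C * 2 ^ k \<ge> 0" by (simp add: C_def)
  have "norm (trib s0 s1 s2 (Suc (Suc (Suc k)))) \<le>
        norm (trib s0 s1 s2 (Suc (Suc k))) + norm (trib s0 s1 s2 (Suc k)) + norm (trib s0 s1 s2 k)"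
    by (simp add: norm_triangle_le norm_triangle_mono)
  also have "\<dots> \<le> C * 2 ^ Suc (Suc k) + C * 2 ^ Suc k + C * 2 ^ k"
    using 4 unfolding C_def by (intro add_mono)
  also have "\<dots> \<le> C * 2 ^ Suc (Suc (Suc k))"
    using C by simp
  finally show ?case by (simp add: C_def)
next
  case (2 s0 s1 s2)
  show ?case using norm_ge_zero[of s0] norm_ge_zero[of s1] norm_ge_zero[of s2]
    by (simp add: distrib_right del: norm_ge_zero)
next
  case (3 s0 s1 s2)
  show ?case using norm_ge_zero[of s0] norm_ge_zero[of s1] norm_ge_zero[of s2]
    by (simp add: distrib_right del: norm_ge_zero)
qed simp

text \<open>The exponential generating function of \<^const>\<open>trib\<close> converges everywhere, so the infinite
  sums formed with it are genuine values.\<close>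

lemma summable_trib_egf:
  "summable (\<lambda>k. trib s0 s1 s2 k * x ^ k / fact k)"
proof (rule summable_comparison_test')
  show "summable (\<lambda>k. (norm s0 + norm s1 + norm s2) * (inverse (fact k) * (2 * norm x) ^ k))"
    by (intro summable_mult summable_exp)
  show "norm (trib s0 s1 s2 k * x ^ k / fact k) \<le>
        (norm s0 + norm s1 + norm s2) * (inverse (fact k) * (2 * norm x) ^ k)" if "k \<ge> 0" for k
  proof -
    have "norm (trib s0 s1 s2 k) * (norm x ^ k * inverse (fact k)) \<le>
          (norm s0 + norm s1 + norm s2) * 2 ^ k * (norm x ^ k * inverse (fact k))"
      by (intro mult_right_mono norm_trib_le) simp
    then show ?thesis
      by (simp add: norm_mult norm_divide norm_power power_mult_distrib field_simps)
  qed
qed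

end

theory Submission
  imports Defs
begin

text \<open>Comparing Taylor coefficients, \<open>T\<^sub>k / A\<close> equals a combination \<open>a \<alpha>\<^sup>k + b \<beta>\<^sup>k + c \<gamma>\<^sup>k\<close>, so
  the binomial convolution of such a sequence with itself consists of diagonal terms
  \<open>(2\<alpha>)\<^sup>m\<close> and cross terms such as \<open>(\<beta> + \<gamma>)\<^sup>m\<close>. As \<open>\<alpha> + \<beta> + \<gamma> = 1\<close>, the latter is
  \<open>(1 - \<alpha>)\<^sup>m\<close>, which expands to an alternating binomial sum.\<close>

text \<open>The difference of the two series vanishes identically. By strong induction its
  coefficients below \<open>k\<close> are zero, so \<open>x ^ k\<close> can be divided out, and
  letting x tend to 0 isolates the coefficient at \<open>k\<close>.\<close>

lemma egf_coeff_unique: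
  fixes f g :: "nat \<Rightarrow> complex"
  assumes "\<And>x. (\<lambda>k. f k * x ^ k / fact k) sums F x"
    and "\<And>x. (\<lambda>k. g k * x ^ k / fact k) sums F x"
  shows "f k = g k"
proof -
  define d where "d k = (f k - g k) / fact k" for k
  have d: "(\<lambda>k. d k * x ^ k) sums 0" for x
    using sums_diff[OF assms(1)[of x] assms(2)[of x]]
    by (simp add: d_def diff_divide_distrib left_diff_distrib)
  have "d k = 0"
  proof (induction k rule: less_induct)
    case (less k)
    have "(\<lambda>n. d (n + k) * x ^ n) sums 0" if "x \<noteq> 0" for x
    proof -
      have "(\<lambda>n. d (n + k) * x ^ (n + k)) sums 0"
        using sums_split_initial_segment[OF d[of x], of k] less by simp
      then have "(\<lambda>n. inverse (x ^ k) * (d (n + k) * x ^ (n + k))) sums (inverse (x ^ k) * 0)"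
        by (rule sums_mult)
      then show ?thesis
        using that by (simp add: power_add field_simps)
    qed
    \<comment> \<open>This limit rule asks for the sum only at nonzero x in a disc (radius 1 is an
      arbitrary choice), which is exactly where dividing by \<open>x ^ k\<close> is valid.\<close>
    then have "((\<lambda>_. 0) \<longlongrightarrow> d (0 + k)) (at (0 :: complex))"
      by (intro powser_limit_0_strong[of 1]) auto
    then show ?case
      by (simp add: tendsto_const_iff)
  qed
  then show ?thesis by (simp add: d_def)
qed

lemma exp_egf_sums:
  fixes a x :: complex
  shows "(\<lambda>k. a ^ k * x ^ k / fact k) sums exp (a * x)"
  using exp_converges[of "a * x"] by (simp add: scaleR_conv_of_real field_simps)

text \<open>A Binet-type formula read off from the generating function: after multiplication by
  \<open>A\<close>, both sides are coefficients of the same everywhere convergent series.\<close>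

lemma trib_eq_power_sum:
  assumes "A \<noteq> 0"
    and "\<And>x. a * exp (\<alpha> * x) + b * exp (\<beta> * x) + c * exp (\<gamma> * x) =
      1 / A * (\<Sum>k. trib s0 s1 s2 k * x ^ k / fact k)"
  shows "trib s0 s1 s2 k = A * (a * \<alpha> ^ k + b * \<beta> ^ k + c * \<gamma> ^ k)"
proof (rule egf_coeff_unique)
  fix x
  show "(\<lambda>k. trib s0 s1 s2 k * x ^ k / fact k) sums
      (A * (a * exp (\<alpha> * x) + b * exp (\<beta> * x) + c * exp (\<gamma> * x)))"
    using summable_sums[OF summable_trib_egf[of s0 s1 s2 x]] assms by simp
  have "(\<lambda>k. A * (a * (\<alpha> ^ k * x ^ k / fact k) + b * (\<beta> ^ k * x ^ k / fact k) +
        c * (\<gamma> ^ k * x ^ k / fact k))) sums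
      (A * (a * exp (\<alpha> * x) + b * exp (\<beta> * x) + c * exp (\<gamma> * x)))"
    by (intro sums_add sums_mult exp_egf_sums)
  then show "(\<lambda>k. A * (a * \<alpha> ^ k + b * \<beta> ^ k + c * \<gamma> ^ k) * x ^ k / fact k) sums
      (A * (a * exp (\<alpha> * x) + b * exp (\<beta> * x) + c * exp (\<gamma> * x)))"
    by (simp add: algebra_simps add_divide_distrib)
qed

text \<open>Vieta's formula for the quadratic coefficient, obtained by taking divided differences of
  the cubic twice instead of factoring it.\<close>

lemma sum_tribonacci_roots:
  fixes \<alpha> \<beta> \<gamma> :: complex
  assumes "\<alpha> ^ 3 - \<alpha> ^ 2 - \<alpha> - 1 = 0" "\<beta> ^ 3 - \<beta> ^ 2 - \<beta> - 1 = 0" "\<gamma> ^ 3 - \<gamma> ^ 2 - \<gamma> - 1 = 0"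
    and "\<alpha> \<noteq> \<beta>" "\<alpha> \<noteq> \<gamma>" "\<beta> \<noteq> \<gamma>"
  shows "\<alpha> + \<beta> + \<gamma> = 1"
proof -
  have quot: "x ^ 2 + x * y + y ^ 2 - (x + y) - 1 = 0"
    if "x ^ 3 - x ^ 2 - x - 1 = 0" "y ^ 3 - y ^ 2 - y - 1 = 0" "x \<noteq> y" for x y :: complex
  proof -
    have "(x - y) * (x ^ 2 + x * y + y ^ 2 - (x + y) - 1) =
        (x ^ 3 - x ^ 2 - x - 1) - (y ^ 3 - y ^ 2 - y - 1)"
      by algebra
    with that show ?thesis by simp
  qed
  \<comment> \<open>The left side is the difference of the two instances of \<open>quot\<close>, at
    (\<alpha>, \<beta>) and at (\<alpha>, \<gamma>).\<close>
  have "(\<beta> - \<gamma>) * (\<alpha> + \<beta> + \<gamma> - 1) = 0"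
    using quot[of \<alpha> \<beta>] quot[of \<alpha> \<gamma>] assms by algebra
  with assms show ?thesis by simp
qed

text \<open>Expanding the product gives nine binomial sums. The three diagonal ones produce powers
  of 2\<alpha>, 2\<beta>, 2\<gamma>; the other six agree in pairs by symmetry, whence the factor
  2.\<close>

lemma binomial_convolution_power_sum:
  fixes a b c \<alpha> \<beta> \<gamma> :: complex
  assumes "\<And>k. t k = a * \<alpha> ^ k + b * \<beta> ^ k + c * \<gamma> ^ k"
  shows "(\<Sum>k = 0..m. of_nat (m choose k) * t k * t (m - k)) =
    2 ^ m * (a ^ 2 * \<alpha> ^ m + b ^ 2 * \<beta> ^ m + c ^ 2 * \<gamma> ^ m) +
    2 * (b * c * (\<beta> + \<gamma>) ^ m + c * a * (\<gamma> + \<alpha>) ^ m + a * b * (\<alpha> + \<beta>) ^ m)"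
proof -
  define B where "B x y = (\<Sum>k = 0..m. of_nat (m choose k) * x ^ k * y ^ (m - k))" for x y :: complex
  have B: "B x y = (x + y) ^ m" for x y
    by (simp add: B_def binomial_ring atLeast0AtMost)
  have "(\<Sum>k = 0..m. of_nat (m choose k) * t k * t (m - k)) =
      a * a * B \<alpha> \<alpha> + a * b * B \<alpha> \<beta> + a * c * B \<alpha> \<gamma> +
      b * a * B \<beta> \<alpha> + b * b * B \<beta> \<beta> + b * c * B \<beta> \<gamma> +
      c * a * B \<gamma> \<alpha> + c * b * B \<gamma> \<beta> + c * c * B \<gamma> \<gamma>"
    by (simp add: B_def assms sum_distrib_left sum.distrib[symmetric] algebra_simps)
  also have "\<dots> = 2 ^ m * (a ^ 2 * \<alpha> ^ m + b ^ 2 * \<beta> ^ m + c ^ 2 * \<gamma> ^ m) +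
      2 * (b * c * (\<beta> + \<gamma>) ^ m + c * a * (\<gamma> + \<alpha>) ^ m + a * b * (\<alpha> + \<beta>) ^ m)"
    unfolding B
    by (simp add: power2_eq_square power_mult_distrib add.commute algebra_simps flip: mult_2)
  finally show ?thesis .
qed

text \<open>The binomial theorem for 1 + (-x), applied to each root. It serves to turn the cross
  terms back into a sum over the sequence.\<close>

lemma alternating_binomial_power_sum:
  fixes a b c \<alpha> \<beta> \<gamma> :: complex
  shows "(\<Sum>k = 0..m. of_nat (m choose k) * (-1) ^ k * (a * \<alpha> ^ k + b * \<beta> ^ k + c * \<gamma> ^ k)) =
    a * (1 - \<alpha>) ^ m + b * (1 - \<beta>) ^ m + c * (1 - \<gamma>) ^ m"
proof -
  have binom: "(1 - x) ^ m = (\<Sum>k = 0..m. of_nat (m choose k) * (-1) ^ k * x ^ k)" for x :: complex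
    using binomial_ring[of "-x" 1 m] by (simp add: power_minus[of x] atLeast0AtMost mult.assoc)
  show ?thesis
    by (simp add: binom sum_distrib_left sum.distrib[symmetric] algebra_simps)
qed

theorem theorem7:
  fixes \<alpha> \<beta> \<gamma> c1 c2 c3 :: complex
    and A1 s10 s11 s12 A2 s20 s21 s22 :: "nat \<Rightarrow> complex"
    and m n :: nat
  assumes roots: "{x :: complex. x ^ 3 - x ^ 2 - x - 1 = 0} = {\<alpha>, \<beta>, \<gamma>}"
    and distinct: "\<alpha> \<noteq> \<beta>" "\<alpha> \<noteq> \<gamma>" "\<beta> \<noteq> \<gamma>"
    and c1: "c1 = \<alpha> / ((\<alpha> - \<beta>) * (\<alpha> - \<gamma>))"
    and c2: "c2 = \<beta> / ((\<beta> - \<alpha>) * (\<beta> - \<gamma>))"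
    and c3: "c3 = \<gamma> / ((\<gamma> - \<alpha>) * (\<gamma> - \<beta>))"
    and A1: "\<And>N. N \<ge> 1 \<Longrightarrow> A1 N \<noteq> 0"
    and egf1: "\<And>N x. N \<ge> 1 \<Longrightarrow>
      c1 ^ N * exp (\<alpha> * x) + c2 ^ N * exp (\<beta> * x) + c3 ^ N * exp (\<gamma> * x) =
      1 / A1 N * (\<Sum>k. trib (s10 N) (s11 N) (s12 N) k * x ^ k / fact k)"
    and A2: "\<And>N. N \<ge> 1 \<Longrightarrow> A2 N \<noteq> 0"
    and egf2: "\<And>N x. N \<ge> 1 \<Longrightarrow>
      (c2 * c3) ^ N * exp (\<alpha> * x) + (c3 * c1) ^ N * exp (\<beta> * x) + (c1 * c2) ^ N * exp (\<gamma> * x) =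
      1 / A2 N * (\<Sum>k. trib (s20 N) (s21 N) (s22 N) k * x ^ k / fact k)"
    and n: "n \<ge> 1"
  shows "1 / (A1 n) ^ 2 *
      (\<Sum>k = 0..m. of_nat (m choose k) * trib (s10 n) (s11 n) (s12 n) k
                                       * trib (s10 n) (s11 n) (s12 n) (m - k)) =
    2 ^ m / A1 (2 * n) * trib (s10 (2 * n)) (s11 (2 * n)) (s12 (2 * n)) m +
    2 / A2 n * (\<Sum>k = 0..m. of_nat (m choose k) * (-1) ^ k * trib (s20 n) (s21 n) (s22 n) k)"
proof -
  define t where "t k = c1 ^ n * \<alpha> ^ k + c2 ^ n * \<beta> ^ k + c3 ^ n * \<gamma> ^ k" for k
  have sum1: "\<alpha> + \<beta> + \<gamma> = 1"
    using roots distinct by (intro sum_tribonacci_roots) auto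
  then have cross: "\<beta> + \<gamma> = 1 - \<alpha>" "\<gamma> + \<alpha> = 1 - \<beta>" "\<alpha> + \<beta> = 1 - \<gamma>"
    by (simp_all add: algebra_simps)
  have T1: "trib (s10 n) (s11 n) (s12 n) k = A1 n * t k" for k
    unfolding t_def using A1 egf1 n by (intro trib_eq_power_sum) auto
  \<comment> \<open>The index \<open>2 * n\<close> enters because the diagonal terms carry the
    squares of \<open>c1 ^ n\<close>, \<open>c2 ^ n\<close>, \<open>c3 ^ n\<close>.\<close>
  have T1': "trib (s10 (2 * n)) (s11 (2 * n)) (s12 (2 * n)) m =
      A1 (2 * n) * (c1 ^ (2 * n) * \<alpha> ^ m + c2 ^ (2 * n) * \<beta> ^ m + c3 ^ (2 * n) * \<gamma> ^ m)"
    using A1 egf1 n by (intro trib_eq_power_sum) auto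
  \<comment> \<open>The cross term in \<beta> + \<gamma> = 1 - \<alpha> has weight
    \<open>(c2 * c3) ^ n\<close>, which is the weight that \<open>egf2\<close> attaches to \<alpha>;
    the other two follow cyclically.\<close>
  have T2: "trib (s20 n) (s21 n) (s22 n) k =
      A2 n * ((c2 * c3) ^ n * \<alpha> ^ k + (c3 * c1) ^ n * \<beta> ^ k + (c1 * c2) ^ n * \<gamma> ^ k)" for k
    using A2 egf2 n by (intro trib_eq_power_sum) auto
  have "1 / (A1 n) ^ 2 *
      (\<Sum>k = 0..m. of_nat (m choose k) * trib (s10 n) (s11 n) (s12 n) k
                                       * trib (s10 n) (s11 n) (s12 n) (m - k)) =
      (\<Sum>k = 0..m. of_nat (m choose k) * t k * t (m - k))"
    unfolding T1 sum_distrib_left using A1[OF n]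
    by (intro sum.cong) (simp_all add: power2_eq_square)
  also have "\<dots> = 2 ^ m * (c1 ^ (2 * n) * \<alpha> ^ m + c2 ^ (2 * n) * \<beta> ^ m + c3 ^ (2 * n) * \<gamma> ^ m) +
      2 * ((c2 * c3) ^ n * (1 - \<alpha>) ^ m + (c3 * c1) ^ n * (1 - \<beta>) ^ m + (c1 * c2) ^ n * (1 - \<gamma>) ^ m)"
    unfolding binomial_convolution_power_sum[of t, OF t_def] cross
    by (simp add: power_mult_distrib power_even_eq)
  also have "2 ^ m * (c1 ^ (2 * n) * \<alpha> ^ m + c2 ^ (2 * n) * \<beta> ^ m + c3 ^ (2 * n) * \<gamma> ^ m) =
      2 ^ m / A1 (2 * n) * trib (s10 (2 * n)) (s11 (2 * n)) (s12 (2 * n)) m"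
    using A1[of "2 * n"] n by (simp add: T1')
  also have "2 * ((c2 * c3) ^ n * (1 - \<alpha>) ^ m + (c3 * c1) ^ n * (1 - \<beta>) ^ m + (c1 * c2) ^ n * (1 - \<gamma>) ^ m) =
      2 / A2 n * (\<Sum>k = 0..m. of_nat (m choose k) * (-1) ^ k * trib (s20 n) (s21 n) (s22 n) k)"
    unfolding T2 alternating_binomial_power_sum[symmetric] sum_distrib_left using A2[OF n]
    by (intro sum.cong) simp_all
  finally show ?thesis .
qed

end
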